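(* Let $L$ be a bounded, distributive lattice, let $I$ and $I'$ be meet semilattices, and let $C\colon L\times L\to I$ and $C'\colon L\times L\to I'$ be Conley forms. Then there exists a meet semilattice isomorphism $g\colon C(L\times L)\to C'(L\times L)$ such that $C'=g\circ C$.
   Context: Lattices have neutral elements $0,1$. A Conley form on a bounded distributive lattice $L$ with values in a meet semilattice $I$ (a set with an associative, commutative, idempotent operation $\wedge$) is a map $C\colon L\times L\to I$ satisfying, for all $a,b,c,d\in L$: (Absorption) $C(a\vee b,a)=C(b,a)$ and $C(a,a\wedge b)=C(a,b)$; (Distributivity) $C(a\wedge c,b\vee d)=C(a,b)\wedge C(c,d)$; (Monotonicity) $C(a,b)=C(0,1)$ implies $a\le b$. The image $C(L\times L)$ is then a meet subsemilattice of $I$. *)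

theory Defs
  imports Main
begin

text \<open>
  The neutral elements \<open>0\<close> and \<open>1\<close> of a bounded lattice are \<open>\<bottom>\<close> and \<open>\<top>\<close>. They are not
  required to be distinct.
\<close>

locale conley_form =
  opening lattice_syntax +
  fixes C :: "'l::{distrib_lattice, bounded_lattice} \<times> 'l \<Rightarrow> 'i::semilattice_inf"
  assumes absorption_left: "C (a \<squnion> b, a) = C (b, a)"
    and absorption_right: "C (a, a \<sqinter> b) = C (a, b)"
    and distributivity: "C (a \<sqinter> c, b \<squnion> d) = C (a, b) \<sqinter> C (c, d)"
    and monotonicity: "C (a, b) = C (\<bottom>, \<top>) \<Longrightarrow> a \<le> b"

definition meet_subsemilattice :: "'i::semilattice_inf set \<Rightarrow> bool"
  where "meet_subsemilattice A \<longleftrightarrow> (\<forall>x\<in>A. \<forall>y\<in>A. inf x y \<in> A)"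

text \<open>
  The map \<open>g\<close> is total on the ambient type; only its values on \<open>A\<close> matter.
\<close>

definition meet_semilattice_iso ::
    "('i::semilattice_inf \<Rightarrow> 'j::semilattice_inf) \<Rightarrow> 'i set \<Rightarrow> 'j set \<Rightarrow> bool"
  where "meet_semilattice_iso g A B \<longleftrightarrow>
    meet_subsemilattice A \<and> meet_subsemilattice B \<and> bij_betw g A B \<and>
    (\<forall>x\<in>A. \<forall>y\<in>A. g (inf x y) = inf (g x) (g y))"

end

theory Submission
  imports Defs
begin

text \<open>
  A Conley form behaves like the set difference \<open>a - b\<close>: the relation
  \<open>C (a, b) \<le> C (c, d)\<close> holds iff \<open>a \<sqinter> d \<le> b\<close> and \<open>a \<le> b \<squnion> c\<close>, a condition in which \<open>C\<close> does
  not occur. Hence any two Conley forms on the same lattice have the same fibres, so one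
  factors through the other by a bijection of the images, and distributivity makes this
  bijection a homomorphism.
\<close>

context conley_form
begin

unbundle lattice_syntax

text \<open>Absorption leads from \<open>(a, b)\<close> through \<open>(a, a)\<close> and
  \<open>(\<bottom>, a)\<close> to \<open>(\<bottom>, \<top>)\<close>, so
  \<open>C (\<bottom>, \<top>)\<close> acts as the empty difference.\<close>

lemma eq_bot_top_iff: "C (a, b) = C (\<bottom>, \<top>) \<longleftrightarrow> a \<le> b"
proof
  assume "a \<le> b"
  then have "C (a, b) = C (a, a)"
    using absorption_right[of a b] by (simp add: inf_absorb1)
  also have "\<dots> = C (\<bottom>, a)"
    using absorption_left[of a \<bottom>] by simp
  also have "\<dots> = C (\<bottom>, \<top>)"
    using absorption_right[of \<bottom> a] absorption_right[of \<bottom> \<top>] by simp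
  finally show "C (a, b) = C (\<bottom>, \<top>)" .
qed (rule monotonicity)

lemma le_iff: "C (a, b) \<le> C (c, d) \<longleftrightarrow> a \<sqinter> d \<le> b \<and> a \<le> b \<squnion> c"
proof
  assume "C (a, b) \<le> C (c, d)"
  then have eq: "C (a, b) = C (a \<sqinter> c, b \<squnion> d)"
    by (simp add: distributivity inf_absorb1)
  \<comment> \<open>\<open>C (d, \<bottom>)\<close> stands for \<open>d\<close> itself, which is
    disjoint from \<open>c - d\<close>; meeting \<open>eq\<close> with it empties the right
    side.\<close>
  have "C (a \<sqinter> d, b) = C (a, b) \<sqinter> C (d, \<bottom>)"
    using distributivity[of a d b \<bottom>] by simp
  also have "\<dots> = C ((a \<sqinter> c) \<sqinter> d, b \<squnion> d)"
    using distributivity[of "a \<sqinter> c" d "b \<squnion> d" \<bottom>] eq by simp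
  also have "\<dots> = C (\<bottom>, \<top>)"
    unfolding eq_bot_top_iff by (rule le_supI2) (rule inf_le2)
  finally have 1: "a \<sqinter> d \<le> b"
    by (rule monotonicity)
  \<comment> \<open>Likewise \<open>C (\<top>, c)\<close> stands for the complement of
    \<open>c\<close>, again disjoint from \<open>c - d\<close>.\<close>
  have "C (a, b \<squnion> c) = C (a, b) \<sqinter> C (\<top>, c)"
    using distributivity[of a \<top> b c] by simp
  also have "\<dots> = C (a \<sqinter> c, (b \<squnion> d) \<squnion> c)"
    using distributivity[of "a \<sqinter> c" \<top> "b \<squnion> d" c] eq by simp
  also have "\<dots> = C (\<bottom>, \<top>)"
    unfolding eq_bot_top_iff by (rule le_supI2) (rule inf_le2)
  finally have "a \<le> b \<squnion> c"
    by (rule monotonicity)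
  with 1 show "a \<sqinter> d \<le> b \<and> a \<le> b \<squnion> c" ..
next
  assume le: "a \<sqinter> d \<le> b \<and> a \<le> b \<squnion> c"
  \<comment> \<open>By left absorption, \<open>C (x, b)\<close> depends only on \<open>b\<close> and
    \<open>b \<squnion> x\<close>, so comparing joins with \<open>b\<close> suffices.\<close>
  have "b \<squnion> (a \<sqinter> c) = b \<squnion> a"
    using le by (simp add: sup_inf_distrib1 inf_absorb1)
  then have 1: "C (a \<sqinter> c, b) = C (a, b)"
    using absorption_left[of b "a \<sqinter> c"] absorption_left[of b a] by simp
  \<comment> \<open>By right absorption, \<open>C (x, y)\<close> depends only on \<open>x\<close>
    and \<open>x \<sqinter> y\<close>; below \<open>a \<sqinter> c\<close>, joining \<open>d\<close>
    to \<open>b\<close> adds nothing.\<close>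
  have "(a \<sqinter> c) \<sqinter> d \<le> (a \<sqinter> c) \<sqinter> b"
    using le by (auto intro: order_trans[OF inf_mono[OF inf_le1 order_refl]] le_infI1)
  then have "(a \<sqinter> c) \<sqinter> (b \<squnion> d) = (a \<sqinter> c) \<sqinter> b"
    by (simp add: inf_sup_distrib1 sup_absorb1)
  then have "C (a \<sqinter> c, b \<squnion> d) = C (a \<sqinter> c, b)"
    using absorption_right[of "a \<sqinter> c" "b \<squnion> d"] absorption_right[of "a \<sqinter> c" b] by simp
  with 1 have "C (a, b) \<sqinter> C (c, d) = C (a, b)"
    by (simp add: distributivity)
  then show "C (a, b) \<le> C (c, d)"
    by (simp add: le_iff_inf)
qed

text \<open>Projections make distributivity applicable to an unsplit \<open>p\<close>, the form in
  which elements of \<open>range C\<close> arise.\<close>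

lemma inf_eq: "C p \<sqinter> C q = C (fst p \<sqinter> fst q, snd p \<squnion> snd q)"
  by (simp add: distributivity)

lemma meet_subsemilattice_range: "meet_subsemilattice (range C)"
  by (auto simp: meet_subsemilattice_def inf_eq)

end

lemma conley_forms_eq_iff:
  fixes C :: "'l::{distrib_lattice, bounded_lattice} \<times> 'l \<Rightarrow> 'i::semilattice_inf"
    and C' :: "'l \<times> 'l \<Rightarrow> 'j::semilattice_inf"
  assumes "conley_form C" and "conley_form C'"
  shows "C p = C q \<longleftrightarrow> C' p = C' q"
  by (cases p; cases q)
    (simp add: order_eq_iff conley_form.le_iff[OF assms(1)] conley_form.le_iff[OF assms(2)])

theorem theorem1p1:
  fixes C :: "'l::{distrib_lattice, bounded_lattice} \<times> 'l \<Rightarrow> 'i::semilattice_inf"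
    and C' :: "'l \<times> 'l \<Rightarrow> 'j::semilattice_inf"
  assumes "conley_form C" and "conley_form C'"
  shows "\<exists>g. meet_semilattice_iso g (range C) (range C') \<and> C' = g \<circ> C"
proof -
  interpret C: conley_form C by fact
  interpret C': conley_form C' by fact
  \<comment> \<open>\<open>inv C\<close> picks some preimage; on \<open>range C\<close> the choice
    is immaterial, since \<open>C'\<close> is constant on the fibres of \<open>C\<close>.\<close>
  define g where "g = C' \<circ> inv C"
  have fibres: "C p = C q \<longleftrightarrow> C' p = C' q" for p q
    using assms by (rule conley_forms_eq_iff)
  have g: "g (C p) = C' p" for p
    by (simp add: g_def fibres[symmetric] f_inv_into_f)
  have "bij_betw g (range C) (range C')"
    by (auto simp: bij_betw_def inj_on_def g fibres image_image)
  moreover have "\<forall>x\<in>range C. \<forall>y\<in>range C. g (inf x y) = inf (g x) (g y)"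
    by (auto simp: C.inf_eq C'.inf_eq g)
  ultimately have "meet_semilattice_iso g (range C) (range C')"
    by (simp add: meet_semilattice_iso_def C.meet_subsemilattice_range C'.meet_subsemilattice_range)
  moreover have "C' = g \<circ> C"
    by (simp add: fun_eq_iff g)
  ultimately show ?thesis by blast
qed

end
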